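(* Let $(X,\tau,T)$ be an operator topological space and $(Y,\delta)$ a topological space. Let $f:(X,\tau,T)\to(Y,\delta)$ be weakly almost contra-$T^*$-continuous, and suppose that for every g$T^*$r-closed set $A\subseteq X$ the image $f(A)$ is regular closed in $Y$. Then $f$ is a$T^*$r-irresolute.
   Context: $P(X)$ is the power set of $X$; $\mathrm{Cl}$ and $\mathrm{Int}$ denote closure and interior. A set $A$ is regular open if $A=\mathrm{Int}(\mathrm{Cl}(A))$ and regular closed if $A=\mathrm{Cl}(\mathrm{Int}(A))$. An operator topological space $(X,\tau,T)$ is a topological space $(X,\tau)$ with a function $T:P(X)\to P(X)$ such that $U\subseteq T(U)$ for all $U\in\tau$. A set $A\subseteq X$ (not necessarily open) is $T^*$-open if $A\subseteq T(A)$, and $T^*$-closed if its complement is $T^*$-open. $T^*\mathrm{Cl}(A)$ is the intersection of all $T^*$-closed sets containing $A$. A set $A\subseteq X$ is generalized $T^*$-regular closed (g$T^*$r-closed) if $T^*\mathrm{Cl}(A)\subseteq U$ whenever $A\subseteq U$ and $U\subseteq X$ is regular open. A function $f:(X,\tau,T)\to(Y,\delta)$ is weakly almost contra-$T^*$-continuous if for every regular open $V\subseteq Y$ and every regular closed $S\subseteq Y$ with $S\subseteq V$, one has $T^*\mathrm{Cl}(f^{-1}(S))\subseteq f^{-1}(V)$. It is approximately $T^*$-regular irresolute (a$T^*$r-irresolute) if $T^*\mathrm{Cl}(A)\subseteq f^{-1}(V)$ whenever $V\subseteq Y$ is regular open, $A\subseteq X$ is g$T^*$r-closed, and $A\subseteq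 f^{-1}(V)$. *)

theory Defs
  imports "HOL-Analysis.Analysis"
begin

text \<open>
  The underlying set of a space is its \<open>topspace\<close>; subsets, complements, preimages and the
  operator \<open>T\<close> are all taken relative to it.
\<close>

definition regular_open :: "'a topology \<Rightarrow> 'a set \<Rightarrow> bool" where
  "regular_open X A \<longleftrightarrow> A = X interior_of (X closure_of A)"

definition regular_closed :: "'a topology \<Rightarrow> 'a set \<Rightarrow> bool" where
  "regular_closed X A \<longleftrightarrow> A = X closure_of (X interior_of A)"

definition operator_space :: "'a topology \<Rightarrow> ('a set \<Rightarrow> 'a set) \<Rightarrow> bool" where
  "operator_space X T \<longleftrightarrow>
     T \<in> Pow (topspace X) \<rightarrow> Pow (topspace X) \<and> (\<forall>U. openin X U \<longrightarrow> U \<subseteq> T U)"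

definition Tstar_open :: "'a topology \<Rightarrow> ('a set \<Rightarrow> 'a set) \<Rightarrow> 'a set \<Rightarrow> bool" where
  "Tstar_open X T A \<longleftrightarrow> A \<subseteq> topspace X \<and> A \<subseteq> T A"

definition Tstar_closed :: "'a topology \<Rightarrow> ('a set \<Rightarrow> 'a set) \<Rightarrow> 'a set \<Rightarrow> bool" where
  "Tstar_closed X T A \<longleftrightarrow> A \<subseteq> topspace X \<and> Tstar_open X T (topspace X - A)"

text \<open>
  For \<open>A \<subseteq> topspace X\<close> in an operator space the intersected family is nonempty: it contains
  \<open>topspace X\<close>, because the empty set is open.
\<close>

definition Tstar_Cl :: "'a topology \<Rightarrow> ('a set \<Rightarrow> 'a set) \<Rightarrow> 'a set \<Rightarrow> 'a set" where
  "Tstar_Cl X T A = \<Inter> {C. Tstar_closed X T C \<and> A \<subseteq> C}"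

definition gTstar_regular_closed :: "'a topology \<Rightarrow> ('a set \<Rightarrow> 'a set) \<Rightarrow> 'a set \<Rightarrow> bool" where
  "gTstar_regular_closed X T A \<longleftrightarrow>
     A \<subseteq> topspace X \<and> (\<forall>U. regular_open X U \<and> A \<subseteq> U \<longrightarrow> Tstar_Cl X T A \<subseteq> U)"

definition weakly_almost_contra_Tstar_continuous ::
    "'a topology \<Rightarrow> ('a set \<Rightarrow> 'a set) \<Rightarrow> 'b topology \<Rightarrow> ('a \<Rightarrow> 'b) \<Rightarrow> bool" where
  "weakly_almost_contra_Tstar_continuous X T Y f \<longleftrightarrow>
     f \<in> topspace X \<rightarrow> topspace Y \<and>
     (\<forall>V S. regular_open Y V \<and> regular_closed Y S \<and> S \<subseteq> V \<longrightarrow>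
        Tstar_Cl X T (f -` S \<inter> topspace X) \<subseteq> f -` V \<inter> topspace X)"

definition approximately_Tstar_regular_irresolute ::
    "'a topology \<Rightarrow> ('a set \<Rightarrow> 'a set) \<Rightarrow> 'b topology \<Rightarrow> ('a \<Rightarrow> 'b) \<Rightarrow> bool" where
  "approximately_Tstar_regular_irresolute X T Y f \<longleftrightarrow>
     f \<in> topspace X \<rightarrow> topspace Y \<and>
     (\<forall>V A. regular_open Y V \<and> gTstar_regular_closed X T A \<and> A \<subseteq> f -` V \<inter> topspace X \<longrightarrow>
        Tstar_Cl X T A \<subseteq> f -` V \<inter> topspace X)"

end

theory Submission
  imports Defs
begin

text \<open>The image f(A) is itself a regular closed set to which weak almost contra-continuity
  applies: it lies in \<open>V\<close> because \<open>A\<close> lies in the preimage of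
  \<open>V\<close>. Hence the closure \<open>Tstar_Cl\<close> of the preimage of f(A) stays inside
  the preimage of \<open>V\<close>, and monotonicity (\<open>Tstar_Cl_mono\<close>) passes this
  bound down to \<open>A\<close>.\<close>

lemma Tstar_Cl_mono: "A \<subseteq> B \<Longrightarrow> Tstar_Cl X T A \<subseteq> Tstar_Cl X T B"
  unfolding Tstar_Cl_def by blast

theorem proposition10:
  fixes X :: "'a topology" and T :: "'a set \<Rightarrow> 'a set"
    and Y :: "'b topology" and f :: "'a \<Rightarrow> 'b"
  assumes "operator_space X T"
    and "weakly_almost_contra_Tstar_continuous X T Y f"
    and "\<And>A. gTstar_regular_closed X T A \<Longrightarrow> regular_closed Y (f ` A)"
  shows "approximately_Tstar_regular_irresolute X T Y f"
  unfolding approximately_Tstar_regular_irresolute_def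
proof (intro conjI allI impI)
  show "f \<in> topspace X \<rightarrow> topspace Y"
    using assms(2) by (simp add: weakly_almost_contra_Tstar_continuous_def)
next
  fix V A
  assume A: "regular_open Y V \<and> gTstar_regular_closed X T A \<and> A \<subseteq> f -` V \<inter> topspace X"
  \<comment> \<open>This may be strict, since \<open>f\<close> need not be injective.\<close>
  then have "A \<subseteq> f -` (f ` A) \<inter> topspace X"
    by blast
  then have "Tstar_Cl X T A \<subseteq> Tstar_Cl X T (f -` (f ` A) \<inter> topspace X)"
    by (rule Tstar_Cl_mono)
  also have "\<dots> \<subseteq> f -` V \<inter> topspace X"
  proof -
    \<comment> \<open>Generalized closedness of \<open>A\<close> enters here, making f(A) admissible
      as the set \<open>S\<close> in the continuity condition.\<close>
    have "regular_closed Y (f ` A)" and "f ` A \<subseteq> V"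
      using A assms(3) by blast+
    then show ?thesis
      using A assms(2) unfolding weakly_almost_contra_Tstar_continuous_def by blast
  qed
  finally show "Tstar_Cl X T A \<subseteq> f -` V \<inter> topspace X" .
qed

end
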